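(* Let $M \geq 2$ and $N \geq 1$ be integers, let $H=(V(H),E(H))$ be a simple connected undirected graph with $|V(H)|=N$ and $|E(H)|=M-1$, and let $P^H_k$ be the distribution function of the random $K$-out-of-$(M-1)$ system corresponding to $H$. Take $v_0 \in V(H)$ and a new vertex $v^+ \notin V(H)$, and let $G=(V(G),E(G))$ be the graph with $V(G)=V(H)\cup\{v^+\}$ and $E(G)=E(H)\cup\{v_0v^+\}$. Let $P^G_k$ be the distribution function of the random $K$-out-of-$M$ system corresponding to $G$. Then for every integer $k\ge 1$, $$P^G_k=\begin{cases}\displaystyle \left[P^H_k\binom{M-1}{k}+\binom{M-1}{k-1}\right]\Big/\binom{M}{k} & \text{if } 1\le k\le M-1 \text{ and } P^G_{k-1}<1,\\[8pt] 1 & \text{otherwise,}\end{cases}$$ where $\binom{M-1}{0}=1$.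
   Context: For a simple connected undirected graph $G=(V(G),E(G))$, an edge set $F\subset E(G)$ is called a $G$-disconnected set if the graph $G-F$ (same vertex set, edges of $F$ deleted) is not connected; its size is $|F|$. For a simple connected undirected graph $G$ with $|E(G)|=m\ge 1$, each edge is regarded as a unit of a random $K$-out-of-$m$ system, where $K$ is a random variable with values in $\{1,\dots,m\}$. The distribution function $P^G_k=P(K\le k)$, $1\le k\le m$, of the system corresponding to $G$ is the probability that $G$ becomes disconnected when $k$ of its $m$ edges, chosen uniformly at random, are deleted; that is, $$P^G_k=\frac{\#\{F\subset E(G): |F|=k,\ F \text{ is a } G\text{-disconnected set}\}}{\binom{m}{k}}.$$ Being a distribution function of a variable with values in $\{1,\dots,m\}$, it is extended by $P^G_0=0$ and $P^G_k=1$ for $k>m$. *)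

theory Defs
  imports Complex_Main
begin

definition simple_graph :: "'a set \<Rightarrow> 'a set set \<Rightarrow> bool" where
  "simple_graph V E \<longleftrightarrow> finite V \<and> (\<forall>e\<in>E. e \<subseteq> V \<and> card e = 2)"

definition connected_graph :: "'a set \<Rightarrow> 'a set set \<Rightarrow> bool" where
  "connected_graph V E \<longleftrightarrow>
     V \<noteq> {} \<and> (\<forall>u\<in>V. \<forall>v\<in>V. (u, v) \<in> {(x, y). {x, y} \<in> E}\<^sup>*)"

definition disconnected_set :: "'a set \<Rightarrow> 'a set set \<Rightarrow> 'a set set \<Rightarrow> bool" where
  "disconnected_set V E F \<longleftrightarrow> F \<subseteq> E \<and> \<not> connected_graph V (E - F)"

(* Distribution function of the random K-out-of-m system, m = card E, of a graph (V, E).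
   K takes values in {1..m}, which fixes the values at k = 0 and for k > m. *)
definition system_cdf :: "'a set \<Rightarrow> 'a set set \<Rightarrow> nat \<Rightarrow> real" where
  "system_cdf V E k =
     (if k = 0 then 0
      else if k > card E then 1
      else real (card {F. F \<subseteq> E \<and> card F = k \<and> disconnected_set V E F})
             / real (card E choose k))"

end

theory Submission imports Defs begin

(* A k-set F of edges of G either contains the pendant edge, and then it isolates v+, or it is a
   k-set of edges of H, and then G - F is connected iff H - F is. This gives the first case.
   In the second case every set of k - 1 edges is disconnected, hence so is every set of k edges. *)

lemma connected_graph_mono:
  assumes "connected_graph V E" "E \<subseteq> E'"
  shows "connected_graph V E'"
proof -
  have "{(x, y). {x, y} \<in> E}\<^sup>* \<subseteq> {(x, y). {x, y} \<in> E'}\<^sup>*"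
    using assms(2) by (intro rtrancl_mono) auto
  then show ?thesis
    using assms(1) unfolding connected_graph_def by blast
qed

text \<open>Old walks survive the extra edge, and every vertex, \<open>w\<close> included, is then
  linked with \<open>v\<close> in both directions; walks are composed at \<open>v\<close>.\<close>

lemma connected_graph_insert_pendant:
  assumes "connected_graph V E" "v \<in> V"
  shows "connected_graph (insert w V) (insert {v, w} E)"
proof -
  let ?R = "{(x, y). {x, y} \<in> insert {v, w} E}"
  have V: "(x, y) \<in> ?R\<^sup>*" if "x \<in> V" "y \<in> V" for x y
    using connected_graph_mono[OF assms(1), of "insert {v, w} E"] that
    unfolding connected_graph_def by blast
  have vw: "(v, w) \<in> ?R" "(w, v) \<in> ?R"
    by (auto simp: insert_commute)
  have from_v: "(v, x) \<in> ?R\<^sup>*" and to_v: "(x, v) \<in> ?R\<^sup>*" if "x \<in> insert w V" for x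
    using that V[OF assms(2)] V[OF _ assms(2)] vw by blast+
  show ?thesis
    unfolding connected_graph_def using rtrancl_trans[OF to_v from_v] by blast
qed

lemma connected_graph_delete_pendant:
  assumes conn: "connected_graph (insert w V) (insert {v, w} E)"
    and E: "E \<subseteq> Pow V" and "v \<in> V" "w \<notin> V"
  shows "connected_graph V E"
proof -
  let ?R = "{(x, y). {x, y} \<in> E}"
  \<comment> \<open>Retracting \<open>w\<close> onto \<open>v\<close> turns every walk into a walk that avoids the pendant edge.\<close>
  have retract: "(x, if y = w then v else y) \<in> ?R\<^sup>*"
    if "(x, y) \<in> {(x, y). {x, y} \<in> insert {v, w} E}\<^sup>*" "x \<in> V" for x y
    using that
  proof (induction rule: rtrancl_induct)
    case base
    then show ?case using \<open>w \<notin> V\<close> by auto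
  next
    case (step y z)
    then have IH: "(x, if y = w then v else y) \<in> ?R\<^sup>*" by simp
    consider "{y, z} = {v, w}" | "{y, z} \<in> E" using step.hyps by auto
    then show ?case
    proof cases
      case 1
      \<comment> \<open>Both endpoints of the pendant edge retract to \<open>v\<close>, so crossing
        it leaves the retracted walk where it is.\<close>
      then show ?thesis using IH by (auto simp: doubleton_eq_iff split: if_splits)
    next
      case 2
      then have "y \<noteq> w" "z \<noteq> w" using E \<open>w \<notin> V\<close> by blast+
      with IH 2 show ?thesis by (auto intro: rtrancl_into_rtrancl)
    qed
  qed
  have "(x, y) \<in> ?R\<^sup>*" if "x \<in> V" "y \<in> V" for x y
    using retract[of x y] conn that \<open>w \<notin> V\<close> unfolding connected_graph_def
    by (auto split: if_splits)
  then show ?thesis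
    using \<open>v \<in> V\<close> unfolding connected_graph_def by blast
qed

text \<open>No edge contains \<open>w\<close>, so a walk leaving \<open>w\<close> has no first step
  and cannot reach \<open>v\<close>, which differs from \<open>w\<close>.\<close>

lemma not_connected_graph_isolated:
  assumes "E \<subseteq> Pow V" "v \<in> V" "w \<notin> V"
  shows "\<not> connected_graph (insert w V) E"
proof
  assume "connected_graph (insert w V) E"
  then have "(w, v) \<in> {(x, y). {x, y} \<in> E}\<^sup>*"
    using assms(2) unfolding connected_graph_def by blast
  then show False
    using assms by (cases rule: converse_rtranclE) blast+
qed

lemma disconnected_set_mono:
  assumes "disconnected_set V E F" "F \<subseteq> F'" "F' \<subseteq> E"
  shows "disconnected_set V E F'"
  using assms connected_graph_mono[of V "E - F'" "E - F"] Diff_mono[OF order_refl assms(2)]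
  unfolding disconnected_set_def by metis

lemma system_cdf_le_1:
  assumes "finite E"
  shows "system_cdf V E k \<le> 1"
proof -
  have "card {F. F \<subseteq> E \<and> card F = k \<and> disconnected_set V E F} \<le> card {F. F \<subseteq> E \<and> card F = k}"
    using assms by (intro card_mono) auto
  then show ?thesis
    using n_subsets[OF assms, of k] by (auto simp: system_cdf_def divide_le_eq_1)
qed

text \<open>The numerator counts a subfamily of the finite family of all \<open>k\<close>-subsets,
  so the quotient reaches 1 exactly when the two families coincide. The bounds on \<open>k\<close>
  select the quotient branch of \<open>system_cdf\<close> and make the binomial coefficient
  positive.\<close>

lemma one_le_system_cdf_iff:
  assumes "finite E" "1 \<le> k" "k \<le> card E"
  shows "1 \<le> system_cdf V E k \<longleftrightarrow> (\<forall>F. F \<subseteq> E \<and> card F = k \<longrightarrow> disconnected_set V E F)"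
proof -
  let ?A = "{F. F \<subseteq> E \<and> card F = k}"
  let ?D = "{F. F \<subseteq> E \<and> card F = k \<and> disconnected_set V E F}"
  have fin: "finite ?A" using assms(1) by simp
  have sub: "?D \<subseteq> ?A" by blast
  have card_A: "card ?A = card E choose k" using n_subsets[OF assms(1)] .
  have pos: "card E choose k > 0" using assms(3) by simp
  have "system_cdf V E k = real (card ?D) / real (card E choose k)"
    using assms by (simp add: system_cdf_def)
  then have "1 \<le> system_cdf V E k \<longleftrightarrow> card ?A \<le> card ?D"
    unfolding card_A using pos by (simp add: le_divide_eq_1)
  also have "\<dots> \<longleftrightarrow> ?D = ?A"
    using card_seteq[OF fin sub] by (intro iffI) simp_all
  also have "\<dots> \<longleftrightarrow> (\<forall>F. F \<subseteq> E \<and> card F = k \<longrightarrow> disconnected_set V E F)"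
    by blast
  finally show ?thesis .
qed

text \<open>Each set of \<open>Suc k\<close> edges contains one of \<open>k\<close> edges, which
  already disconnects the graph, and deleting one more edge cannot reconnect it.\<close>

lemma system_cdf_eq_1_Suc:
  assumes "finite E" "1 \<le> k" "Suc k \<le> card E" "1 \<le> system_cdf V E k"
  shows "system_cdf V E (Suc k) = 1"
proof (rule antisym)
  show "system_cdf V E (Suc k) \<le> 1"
    using system_cdf_le_1[OF assms(1)] .
  have "disconnected_set V E F" if F: "F \<subseteq> E" "card F = Suc k" for F
  proof -
    obtain F' where F': "F' \<subseteq> F" "card F' = k"
      using obtain_subset_with_card_n[of k F] F(2) by auto
    moreover have "F' \<subseteq> E" using F' F(1) by blast
    ultimately have "disconnected_set V E F'"
      using one_le_system_cdf_iff[of E k V] assms by simp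
    then show ?thesis using disconnected_set_mono F' F(1) by blast
  qed
  then show "1 \<le> system_cdf V E (Suc k)"
    using one_le_system_cdf_iff[of E "Suc k" V] assms(1,3) by simp
qed

lemma card_disconnected_sets_insert_pendant:
  assumes "finite E" and E: "E \<subseteq> Pow V" and "v \<in> V" "w \<notin> V" "1 \<le> k"
  shows "card {F. F \<subseteq> insert {v, w} E \<and> card F = k
            \<and> disconnected_set (insert w V) (insert {v, w} E) F}
       = card {F. F \<subseteq> E \<and> card F = k \<and> disconnected_set V E F} + (card E choose (k - 1))"
proof -
  let ?e = "{v, w}"
  let ?G = "{F. F \<subseteq> insert ?e E \<and> card F = k
            \<and> disconnected_set (insert w V) (insert ?e E) F}"
  let ?H = "{F. F \<subseteq> E \<and> card F = k \<and> disconnected_set V E F}"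
  let ?B = "insert ?e ` {F. F \<subseteq> E \<and> card F = k - 1}"
  have e: "?e \<notin> E" using E assms(4) by blast
  have with_e: "disconnected_set (insert w V) (insert ?e E) F"
    if "F \<subseteq> insert ?e E" "?e \<in> F" for F
  proof -
    have "insert ?e E - F \<subseteq> Pow V" using that(2) E by blast
    from not_connected_graph_isolated[OF this assms(3,4)] show ?thesis
      using that(1) unfolding disconnected_set_def by simp
  qed
  have without_e: "disconnected_set (insert w V) (insert ?e E) F \<longleftrightarrow> disconnected_set V E F"
    if "F \<subseteq> E" for F
  proof -
    \<comment> \<open>Deleting \<open>F\<close> spares the pendant edge, so what remains is
      \<open>E - F\<close> with the pendant edge attached.\<close>
    have eq: "insert ?e E - F = insert ?e (E - F)" using that e by blast
    have "E - F \<subseteq> Pow V" using E by blast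
    then have "connected_graph (insert w V) (insert ?e (E - F)) \<longleftrightarrow> connected_graph V (E - F)"
      using connected_graph_insert_pendant[OF _ assms(3)]
        connected_graph_delete_pendant[OF _ _ assms(3,4)] by blast
    then show ?thesis
      unfolding disconnected_set_def eq using that by auto
  qed
  \<comment> \<open>Here \<open>1 \<le> k\<close> matters: at \<open>k = 0\<close> the truncated
    \<open>k - 1\<close> would be 0 and the enlarged set would have one element.\<close>
  have card_ins: "card (insert ?e F) = k" if "F \<subseteq> E" "card F = k - 1" for F
    using that e assms(1,5) finite_subset[OF that(1)] by (subst card_insert_disjoint) auto
  have "?G = ?H \<union> ?B"
  proof (intro set_eqI iffI)
    fix F assume F: "F \<in> ?G"
    show "F \<in> ?H \<union> ?B"
    proof (cases "?e \<in> F")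
      case True
      have "F - {?e} \<subseteq> E" "card (F - {?e}) = k - 1" using F True by auto
      then have "insert ?e (F - {?e}) \<in> ?B" by blast
      then show ?thesis using True by (simp add: insert_absorb)
    next
      case False
      then show ?thesis using F without_e[of F] by blast
    qed
  next
    fix F assume "F \<in> ?H \<union> ?B"
    then show "F \<in> ?G"
    proof
      assume "F \<in> ?H"
      then show ?thesis using without_e by blast
    next
      assume "F \<in> ?B"
      then obtain F' where F': "F = insert ?e F'" "F' \<subseteq> E" "card F' = k - 1" by blast
      then show ?thesis using with_e[of F] card_ins[of F'] by blast
    qed
  qed
  moreover have "?H \<inter> ?B = {}" using e by blast
  moreover have "finite ?H" "finite ?B" using assms(1) by simp_all
  moreover have "card ?B = card E choose (k - 1)"
  proof -
    have "inj_on (insert ?e) {F. F \<subseteq> E \<and> card F = k - 1}"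
      using e by (intro inj_onI) (metis insert_ident mem_Collect_eq subsetD)
    then show ?thesis
      using n_subsets[OF assms(1)] by (simp add: card_image)
  qed
  ultimately show ?thesis by (simp only: card_Un_disjoint)
qed

theorem theorem4p3:
  fixes VH VG :: "'a set" and EH EG :: "'a set set" and v0 vp :: 'a and M N k :: nat
  assumes "M \<ge> 2" and "N \<ge> 1"
    and "simple_graph VH EH" and "connected_graph VH EH"
    and "card VH = N" and "card EH = M - 1"
    and "v0 \<in> VH" and "vp \<notin> VH"
    and "VG = VH \<union> {vp}" and "EG = EH \<union> {{v0, vp}}"
    and "k \<ge> 1"
  shows "system_cdf VG EG k =
    (if k \<le> M - 1 \<and> system_cdf VG EG (k - 1) < 1
     then (system_cdf VH EH k * real ((M - 1) choose k) + real ((M - 1) choose (k - 1)))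
            / real (M choose k)
     else 1)"
proof -
  have EH: "EH \<subseteq> Pow VH"
    using assms(3) by (auto simp: simple_graph_def)
  have finH: "finite EH"
    using assms(3) EH by (auto simp: simple_graph_def intro: finite_subset[of _ "Pow VH"])
  have VG: "VG = insert vp VH" and EG: "EG = insert {v0, vp} EH"
    using assms(9,10) by auto
  have finG: "finite EG" and cardG: "card EG = M"
    using finH EH assms(1,6,8) by (auto simp: EG card_insert_if)
  \<comment> \<open>The "otherwise" branch of the formula splits into three cases: the value 1 was
    reached earlier, all edges are deleted, or \<open>k\<close> is out of range.\<close>
  consider "k \<le> M - 1" "system_cdf VG EG (k - 1) < 1"
    | "k \<le> M - 1" "1 \<le> system_cdf VG EG (k - 1)" | "k = M" | "k > M"
    by linarith
  then show ?thesis
  proof cases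
    \<comment> \<open>Since \<open>k \<le> card EH\<close>, multiplying the quotient for
      \<open>H\<close> by its nonzero binomial coefficient gives back the number of disconnecting
      \<open>k\<close>-sets of \<open>H\<close>.\<close>
    case 1
    then show ?thesis
      using card_disconnected_sets_insert_pendant[OF finH EH assms(7,8,11)] assms(1,6,11) cardG
      by (simp add: system_cdf_def VG EG)
  next
    case 2
    \<comment> \<open>The value at 0 is 0 by definition, so \<open>k - 1 = 0\<close> would
      contradict the case assumption.\<close>
    then have "k - 1 \<ge> 1" by (cases "k - 1") (auto simp: system_cdf_def)
    then show ?thesis
      using system_cdf_eq_1_Suc[OF finG, of "k - 1" VG] 2 cardG by simp
  next
    case 3
    \<comment> \<open>The only set of \<open>M\<close> edges is \<open>EG\<close> itself, and
      deleting it leaves an edgeless graph on at least the two vertices \<open>v0\<close> and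
      \<open>vp\<close>.\<close>
    have "\<not> connected_graph VG {}"
      unfolding VG using not_connected_graph_isolated[OF _ assms(7,8)] by simp
    then have "\<forall>F. F \<subseteq> EG \<and> card F = M \<longrightarrow> disconnected_set VG EG F"
      using card_subset_eq[OF finG] cardG by (metis Diff_cancel disconnected_set_def)
    then have "system_cdf VG EG M = 1"
      using one_le_system_cdf_iff[OF finG, of M VG] system_cdf_le_1[OF finG, of VG M] assms(1) cardG
      by simp
    moreover have "\<not> k \<le> M - 1" using 3 assms(1) by linarith
    ultimately show ?thesis using 3 by simp
  next
    case 4
    then have "\<not> k \<le> M - 1" "system_cdf VG EG k = 1"
      using cardG by (simp_all add: system_cdf_def)
    then show ?thesis by simp
  qed
qed

end
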